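(* Let $\mathcal{H}$ be a complex Hilbert space and let $A,B\in\mathbb{B}(\mathcal{H})$ be two self-adjoint operators. Then $$\|A+B\|\le \sqrt{\omega^2(A+iB)+2\|A\|\,\|B\|}\le \|A\|+\|B\|.$$
   Context: $\mathbb{B}(\mathcal{H})$ is the $C^*$-algebra of bounded linear operators on $\mathcal{H}$, with the usual operator norm $\|\cdot\|$. The numerical radius is $\omega(T)=\sup_{\|x\|=1}|\langle Tx,x\rangle|$, and $\omega^2(T)$ means $(\omega(T))^2$. *)

theory Defs
  imports "HOL-Analysis.Analysis"
begin

class complex_vector = real_vector +
  fixes scaleC :: "complex \<Rightarrow> 'a \<Rightarrow> 'a"  (infixr "*\<^sub>C" 75)
  assumes scaleC_add_right: "c *\<^sub>C (x + y) = c *\<^sub>C x + c *\<^sub>C y"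
    and scaleC_add_left: "(c + d) *\<^sub>C x = c *\<^sub>C x + d *\<^sub>C x"
    and scaleC_scaleC: "c *\<^sub>C d *\<^sub>C x = (c * d) *\<^sub>C x"
    and scaleC_of_real: "complex_of_real r *\<^sub>C x = r *\<^sub>R x"

text \<open>The inner product is linear in its first argument.\<close>

class complex_inner = complex_vector + real_normed_vector +
  fixes cinner :: "'a \<Rightarrow> 'a \<Rightarrow> complex"
  assumes cinner_commute: "cinner x y = cnj (cinner y x)"
    and cinner_add_left: "cinner (x + y) z = cinner x z + cinner y z"
    and cinner_scaleC_left: "cinner (c *\<^sub>C x) y = c * cinner x y"
    and cinner_ge_zero: "0 \<le> Re (cinner x x)"
    and cinner_eq_zero_iff: "cinner x x = 0 \<longleftrightarrow> x = 0"
    and norm_eq_sqrt_cinner: "norm x = sqrt (Re (cinner x x))"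

class complex_hilbert_space = complex_inner + complete_space

text \<open>Elements of $B(H)$ are functions satisfying the following predicate; their operator
  norm is \<^const>\<open>onorm\<close>.\<close>

definition bounded_clinear :: "('a::complex_inner \<Rightarrow> 'b::complex_inner) \<Rightarrow> bool"
  where "bounded_clinear T \<longleftrightarrow> bounded_linear T \<and> (\<forall>c x. T (c *\<^sub>C x) = c *\<^sub>C T x)"

definition is_adjoint :: "('a::complex_inner \<Rightarrow> 'b::complex_inner) \<Rightarrow> ('b \<Rightarrow> 'a) \<Rightarrow> bool"
  where "is_adjoint T S \<longleftrightarrow> (\<forall>x y. cinner (T x) y = cinner x (S y))"

definition self_adjoint :: "('a::complex_inner \<Rightarrow> 'a) \<Rightarrow> bool"
  where "self_adjoint T \<longleftrightarrow> is_adjoint T T"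

text \<open>Adjoining 0 only matters for the zero space, where there are no unit vectors and the real
  supremum of the empty set is unspecified; otherwise all the values are nonnegative.\<close>

definition numerical_radius :: "('a::complex_inner \<Rightarrow> 'a) \<Rightarrow> real"
  where "numerical_radius T = Sup (insert 0 {cmod (cinner (T x) x) | x. norm x = 1})"

end

(* For a unit vector x the numbers a = <Ax,x> and b = <Bx,x> are real, so
   |<(A+iB)x,x>|^2 = a^2 + b^2.  Bounding a and b by the operator norms gives the second inequality.
   For the first one, (a+b)^2 = (a^2+b^2) + 2ab bounds the quadratic form of A+B, and by polarization
   the norm of a self-adjoint operator is bounded by its quadratic form. *)

theory Submission imports Defs begin

lemma cinner_add_right: "cinner x (y + z) = cinner x y + cinner x z"
  by (metis cinner_add_left cinner_commute complex_cnj_add)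

lemma cinner_scaleC_right: "cinner x (c *\<^sub>C y) = cnj c * cinner x y"
  by (metis cinner_commute cinner_scaleC_left complex_cnj_mult)

lemma cinner_scaleR_left: "cinner (r *\<^sub>R x) y = of_real r * cinner x y"
  by (metis cinner_scaleC_left scaleC_of_real)

lemma cinner_scaleR_right: "cinner x (r *\<^sub>R y) = of_real r * cinner x y"
  by (metis cinner_scaleC_right complex_cnj_complex_of_real scaleC_of_real)

lemma cinner_minus_left: "cinner (- x) y = - cinner x y"
  using cinner_scaleR_left[of "-1" x y] by simp

lemma cinner_minus_right: "cinner x (- y) = - cinner x y"
  using cinner_scaleR_right[of x "-1" y] by simp

lemma cinner_diff_left: "cinner (x - y) z = cinner x z - cinner y z"
  using cinner_add_left[of x "- y" z] by (simp add: cinner_minus_left)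

lemma cinner_diff_right: "cinner x (y - z) = cinner x y - cinner x z"
  using cinner_add_right[of x y "- z"] by (simp add: cinner_minus_right)

lemma Re_cinner_self: "Re (cinner x x) = (norm x)\<^sup>2"
  by (simp add: norm_eq_sqrt_cinner cinner_ge_zero)

text \<open>The class provides homogeneity of the norm for real scalars only; for complex ones it
  follows from sesquilinearity, since \<open>c * cnj c\<close> is the squared modulus of
  \<open>c\<close>.\<close>

lemma norm_scaleC: "norm (c *\<^sub>C x) = cmod c * norm (x::'a::complex_inner)"
proof (rule power2_eq_imp_eq)
  have "cinner (c *\<^sub>C x) (c *\<^sub>C x) = of_real ((cmod c)\<^sup>2) * cinner x x"
    using complex_norm_square[of c] by (simp add: cinner_scaleC_left cinner_scaleC_right)
  then show "(norm (c *\<^sub>C x))\<^sup>2 = (cmod c * norm x)\<^sup>2"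
    by (simp add: Re_cinner_self[symmetric] power_mult_distrib del: of_real_power)
qed auto

lemma Re_cinner_commute: "Re (cinner x y) = Re (cinner y x)"
  by (metis cinner_commute complex_cnj(1) complex.collapse complex.sel(1))

lemma norm_add_square:
  "(norm (x + y))\<^sup>2 = (norm x)\<^sup>2 + (norm y)\<^sup>2 + 2 * Re (cinner x (y::'a::complex_inner))"
  using Re_cinner_commute[of y x]
  by (simp add: Re_cinner_self[symmetric] cinner_add_left cinner_add_right)

lemma parallelogram_law:
  "(norm (x + y))\<^sup>2 + (norm (x - y))\<^sup>2 = 2 * (norm x)\<^sup>2 + 2 * (norm (y::'a::complex_inner))\<^sup>2"
  using norm_add_square[of x y] norm_add_square[of x "- y"] by (simp add: cinner_minus_right)

text \<open>The triangle inequality is part of \<^class>\<open>real_normed_vector\<close>, so it can be used to prove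
  Cauchy--Schwarz.\<close>

lemma Re_cinner_le_norm: "Re (cinner x y) \<le> norm x * norm (y::'a::complex_inner)"
proof -
  have "(norm (x + y))\<^sup>2 \<le> (norm x + norm y)\<^sup>2"
    by (intro power_mono norm_triangle_ineq) simp
  then show ?thesis
    by (simp add: norm_add_square power2_sum)
qed

text \<open>Multiplying \<open>x\<close> by a unimodular \<open>c\<close> keeps its norm and rotates
  the inner product onto the nonnegative real axis, where the bound on real parts applies.\<close>

lemma cmod_cinner_le_norm: "cmod (cinner x y) \<le> norm x * norm (y::'a::complex_inner)"
proof (cases "cinner x y = 0")
  case False
  define c where "c = cnj (cinner x y) / of_real (cmod (cinner x y))"
  have "cmod c = 1"
    using False by (simp add: c_def norm_divide)
  moreover have "cinner (c *\<^sub>C x) y = of_real (cmod (cinner x y))"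
    using False complex_norm_square[of "cinner x y"]
    by (simp add: c_def cinner_scaleC_left field_simps power2_eq_square)
  ultimately show ?thesis
    using Re_cinner_le_norm[of "c *\<^sub>C x" y] by (simp add: norm_scaleC)
qed simp

text \<open>Cauchy--Schwarz followed by the operator norm bound. It makes the set defining the
  numerical radius bounded, and later bounds the forms of \<open>A\<close> and
  \<open>B\<close>.\<close>

lemma cmod_cinner_le_onorm:
  fixes T :: "'a::complex_inner \<Rightarrow> 'a"
  assumes "bounded_linear T"
  shows "cmod (cinner (T x) x) \<le> onorm T * (norm x)\<^sup>2"
proof -
  have "cmod (cinner (T x) x) \<le> norm (T x) * norm x"
    by (rule cmod_cinner_le_norm)
  also have "\<dots> \<le> (onorm T * norm x) * norm x"
    by (intro mult_right_mono onorm assms) simp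
  finally show ?thesis
    by (simp add: power2_eq_square mult.assoc)
qed

lemma self_adjoint_cinner_real:
  assumes "self_adjoint T"
  shows "cinner (T x) x = of_real (Re (cinner (T x) x))"
proof -
  have "cinner (T x) x = cnj (cinner (T x) x)"
    using assms cinner_commute[of x "T x"] by (simp add: self_adjoint_def is_adjoint_def)
  then show ?thesis
    by (metis Reals_cnj_iff of_real_Re)
qed

lemma self_adjoint_add:
  "self_adjoint A \<Longrightarrow> self_adjoint B \<Longrightarrow> self_adjoint (\<lambda>x. A x + B x)"
  by (simp add: self_adjoint_def is_adjoint_def cinner_add_left cinner_add_right)

lemma bounded_linear_scaleC: "bounded_linear (\<lambda>x::'a::complex_inner. c *\<^sub>C x)"
proof (rule bounded_linear_intro)
  show "c *\<^sub>C (r *\<^sub>R x) = r *\<^sub>R (c *\<^sub>C x)" for r and x :: 'a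
    by (metis mult.commute scaleC_of_real scaleC_scaleC)
  show "norm (c *\<^sub>C x) \<le> norm x * cmod c" for x :: 'a
    by (simp add: norm_scaleC mult.commute)
qed (rule scaleC_add_right)

text \<open>The hypothesis \<open>0 \<le> M\<close> accounts for the 0 adjoined to the set in the
  definition.\<close>

lemma numerical_radius_le:
  assumes "0 \<le> M" "\<And>x. norm x = 1 \<Longrightarrow> cmod (cinner (T x) x) \<le> M"
  shows "numerical_radius T \<le> M"
  unfolding numerical_radius_def using assms by (intro cSup_least) auto

lemma
  fixes T :: "'a::complex_inner \<Rightarrow> 'a"
  assumes T: "bounded_linear T"
  shows numerical_radius_nonneg: "0 \<le> numerical_radius T"
    and cmod_cinner_le_numerical_radius:
      "cmod (cinner (T x) x) \<le> numerical_radius T * (norm x)\<^sup>2"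
proof -
  let ?S = "insert 0 {cmod (cinner (T x) x) | x. norm x = 1}"
  \<comment> \<open>A real supremum dominates the members of its set only once the set is known to
    be bounded above.\<close>
  have bdd: "bdd_above ?S"
  proof (rule bdd_aboveI)
    fix r assume "r \<in> ?S"
    then show "r \<le> onorm T"
      using cmod_cinner_le_onorm[OF T] onorm_pos_le[OF T]
      by auto (metis mult.right_neutral one_power2)
  qed
  show "0 \<le> numerical_radius T"
    unfolding numerical_radius_def by (rule cSup_upper[OF _ bdd]) simp
  show "cmod (cinner (T x) x) \<le> numerical_radius T * (norm x)\<^sup>2"
  proof (cases "x = 0")
    case True
    then show ?thesis
      using cmod_cinner_le_norm[of "T x" x] by simp
  next
    case False
    \<comment> \<open>The supremum ranges over unit vectors; the quadratic form scales by the square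
      of the norm, which carries the bound from \<open>u\<close> to \<open>x\<close>.\<close>
    define u where "u = x /\<^sub>R norm x"
    have x: "x = norm x *\<^sub>R u" and u: "norm u = 1"
      using False by (simp_all add: u_def)
    have "cinner (T x) x = of_real (norm x) * (of_real (norm x) * cinner (T u) u)"
      by (subst (1 2) x)
        (simp add: linear_simps(5)[OF T] cinner_scaleR_left cinner_scaleR_right)
    then have "cmod (cinner (T x) x) = cmod (cinner (T u) u) * (norm x)\<^sup>2"
      by (simp add: norm_mult power2_eq_square)
    moreover have "cmod (cinner (T u) u) \<le> numerical_radius T"
      unfolding numerical_radius_def by (rule cSup_upper[OF _ bdd]) (use u in auto)
    ultimately show ?thesis
      by (simp add: mult_right_mono)
  qed
qed

lemma self_adjoint_onorm_le:
  fixes T :: "'a::complex_inner \<Rightarrow> 'a"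
  assumes T: "bounded_linear T" and sa: "self_adjoint T"
    and M: "0 \<le> M" "\<And>x. \<bar>Re (cinner (T x) x)\<bar> \<le> M * (norm x)\<^sup>2"
  shows "onorm T \<le> M"
proof (rule onorm_bound[OF M(1)])
  fix x
  show "norm (T x) \<le> M * norm x"
  proof (cases "T x = 0 \<or> x = 0")
    case True
    then show ?thesis
      using M(1) linear_simps(3)[OF T] by auto
  next
    case False
    \<comment> \<open>The direction of \<open>T x\<close> gives equality in Cauchy--Schwarz, and the
      length of \<open>x\<close> makes the parallelogram sum below equal to 4 times the square of
      \<open>norm x\<close>.\<close>
    define y where "y = (norm x / norm (T x)) *\<^sub>R T x"
    have ny: "norm y = norm x"
      using False by (simp add: y_def)
    have Txy: "Re (cinner (T x) y) = norm x * norm (T x)"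
      using False by (simp add: y_def cinner_scaleR_right Re_cinner_self power2_eq_square)
    \<comment> \<open>Self-adjointness makes the two cross terms of the polarization identity
      agree.\<close>
    have "Re (cinner (T y) x) = Re (cinner (T x) y)"
      using sa Re_cinner_commute[of y "T x"] by (simp add: self_adjoint_def is_adjoint_def)
    then have "4 * Re (cinner (T x) y)
        = Re (cinner (T (x + y)) (x + y)) - Re (cinner (T (x - y)) (x - y))"
      by (simp add: linear_simps(1,2)[OF T] cinner_add_left cinner_add_right
          cinner_diff_left cinner_diff_right)
    also have "\<dots> \<le> M * (norm (x + y))\<^sup>2 + M * (norm (x - y))\<^sup>2"
      using M(2)[of "x + y"] M(2)[of "x - y"] by linarith
    also have "\<dots> = 4 * (M * norm x * norm x)"
      unfolding distrib_left[symmetric] parallelogram_law ny by (simp add: power2_eq_square)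
    \<comment> \<open>The chain bounds \<open>norm x * norm (T x)\<close> by
      \<open>M * norm x * norm x\<close>; the nonzero factor \<open>norm x\<close> cancels.\<close>
    finally show ?thesis
      using False by (simp add: Txy)
  qed
qed

theorem theorem2p4:
  fixes A B :: "'a::complex_hilbert_space \<Rightarrow> 'a"
  assumes "bounded_clinear A" and "self_adjoint A"
    and "bounded_clinear B" and "self_adjoint B"
  shows "onorm (\<lambda>x. A x + B x)
      \<le> sqrt ((numerical_radius (\<lambda>x. A x + \<i> *\<^sub>C B x))\<^sup>2 + 2 * onorm A * onorm B)
    \<and> sqrt ((numerical_radius (\<lambda>x. A x + \<i> *\<^sub>C B x))\<^sup>2 + 2 * onorm A * onorm B)
      \<le> onorm A + onorm B"
proof -
  let ?T = "\<lambda>x. A x + \<i> *\<^sub>C B x"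
  define w where "w = numerical_radius ?T"
  define a where "a x = Re (cinner (A x) x)" for x
  define b where "b x = Re (cinner (B x) x)" for x
  have A: "bounded_linear A" and B: "bounded_linear B"
    using assms by (auto simp: bounded_clinear_def)
  have T: "bounded_linear ?T"
    by (intro bounded_linear_add A bounded_linear_compose[OF bounded_linear_scaleC B])
  have nonneg: "0 \<le> onorm A" "0 \<le> onorm B" "0 \<le> w"
    using onorm_pos_le[OF A] onorm_pos_le[OF B] numerical_radius_nonneg[OF T]
    by (auto simp: w_def)
  have a_le: "\<bar>a x\<bar> \<le> onorm A * (norm x)\<^sup>2" and b_le: "\<bar>b x\<bar> \<le> onorm B * (norm x)\<^sup>2" for x
    using cmod_cinner_le_onorm[OF A, of x] cmod_cinner_le_onorm[OF B, of x]
    unfolding a_def b_def by (meson abs_Re_le_cmod order_trans)+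
  have "cinner (?T x) x = Complex (a x) (b x)" for x
    using self_adjoint_cinner_real[OF assms(2), of x] self_adjoint_cinner_real[OF assms(4), of x]
    by (simp add: cinner_add_left cinner_scaleC_left a_def b_def complex_eq_iff)
  then have form: "(cmod (cinner (?T x) x))\<^sup>2 = (a x)\<^sup>2 + (b x)\<^sup>2" for x
    by (simp add: cmod_power2)

  \<comment> \<open>On unit vectors the two squares in \<open>form\<close> are bounded
    separately.\<close>
  have "w \<le> sqrt ((onorm A)\<^sup>2 + (onorm B)\<^sup>2)"
    unfolding w_def
  proof (rule numerical_radius_le)
    fix x :: 'a assume "norm x = 1"
    then have "(a x)\<^sup>2 \<le> (onorm A)\<^sup>2" "(b x)\<^sup>2 \<le> (onorm B)\<^sup>2"
      using a_le[of x] b_le[of x] by (auto simp: abs_le_square_iff[symmetric])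
    then show "cmod (cinner (?T x) x) \<le> sqrt ((onorm A)\<^sup>2 + (onorm B)\<^sup>2)"
      by (intro real_le_rsqrt) (simp add: form)
  qed simp
  then have "w\<^sup>2 \<le> (onorm A)\<^sup>2 + (onorm B)\<^sup>2"
    using nonneg by (simp add: real_le_rsqrt sqrt_ge_absD)
  \<comment> \<open>The added term \<open>2 * onorm A * onorm B\<close> completes the square of
    \<open>onorm A + onorm B\<close>.\<close>
  then have second: "sqrt (w\<^sup>2 + 2 * onorm A * onorm B) \<le> onorm A + onorm B"
    using nonneg by (intro real_le_lsqrt) (auto simp: power2_sum)

  \<comment> \<open>The bound is stated for all vectors, not just unit ones, because polarization
    evaluates the form at \<open>x + y\<close> and \<open>x - y\<close>.\<close>
  have "\<bar>Re (cinner (A x + B x) x)\<bar> \<le> sqrt (w\<^sup>2 + 2 * onorm A * onorm B) * (norm x)\<^sup>2" for x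
  proof (rule power2_le_imp_le)
    have "(cmod (cinner (?T x) x))\<^sup>2 \<le> (w * (norm x)\<^sup>2)\<^sup>2"
      unfolding w_def by (intro power_mono cmod_cinner_le_numerical_radius T) simp
    then have "(a x)\<^sup>2 + (b x)\<^sup>2 \<le> w\<^sup>2 * ((norm x)\<^sup>2)\<^sup>2"
      by (simp add: form power_mult_distrib)
    \<comment> \<open>The forms may be negative, so the product is bounded through absolute
      values.\<close>
    moreover have "a x * b x \<le> (onorm A * (norm x)\<^sup>2) * (onorm B * (norm x)\<^sup>2)"
      using mult_mono[OF a_le[of x] b_le[of x]] nonneg abs_ge_self[of "a x * b x"]
      by (simp add: abs_mult)
    ultimately have "(a x + b x)\<^sup>2 \<le> (w\<^sup>2 + 2 * onorm A * onorm B) * ((norm x)\<^sup>2)\<^sup>2"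
      by (simp add: power2_sum power2_eq_square algebra_simps)
    then show "\<bar>Re (cinner (A x + B x) x)\<bar>\<^sup>2
        \<le> (sqrt (w\<^sup>2 + 2 * onorm A * onorm B) * (norm x)\<^sup>2)\<^sup>2"
      using nonneg by (simp add: power_mult_distrib cinner_add_left a_def b_def)
  qed (use nonneg in simp)
  then have "onorm (\<lambda>x. A x + B x) \<le> sqrt (w\<^sup>2 + 2 * onorm A * onorm B)"
    using nonneg
    by (intro self_adjoint_onorm_le bounded_linear_add A B self_adjoint_add assms) auto
  with second show ?thesis
    by (simp add: w_def)
qed

end
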